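(* Let $\mathscr D=\{d_1,\ldots,d_n\}$ be a set of positive integers with $d_1>d_2>\cdots>d_n$ and $\min\mathscr D=d_n=2$. Define $C^{\star}$ as follows. If $\sigma(\mathscr D)$ is even: let $\mathbf s=d_1,\ldots,d_n$, $c=\max_{1\le k\le n-1}\left\lceil \frac{-\Delta_{\mathbf s}(k)}{\min\{k,2\}}\right\rceil$, and $C^{\star}=c$. If $\sigma(\mathscr D)$ is odd: let $r=\max\{i: d_i\text{ is odd}\}$, let $\mathbf s=d_1,\ldots,d_{r-1},(d_r)_2,d_{r+1},\ldots,d_n$, and $C^{\star}=\max_{1\le k\le n}\left\lceil \frac{-\Delta_{\mathbf s}(k)}{\min\{k,2\}}\right\rceil$. Then \[ \ell_q(\mathscr D)=\tfrac12\big(\sigma(\mathscr D)+2C^{\star}\big)+\begin{cases}0 & \text{if }\sigma(\mathscr D)\text{ is even};\\ \tfrac12 d_r & \text{if }\sigma(\mathscr D)\text{ is odd}.\end{cases} \]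
   Context: All graphs are finite and simple. The degree set of a graph $G$ is the set of distinct degrees of its vertices. For a finite nonempty set $\mathscr D$ of positive integers, $\ell_q(\mathscr D)$ denotes the least number of edges of a simple graph whose degree set is exactly $\mathscr D$. $\sigma(\mathscr D)$ is the sum of the elements of $\mathscr D$. The notation $(d)_m$ denotes $m$ consecutive occurrences of $d$ in a sequence. For a sequence $\mathbf s=a_1,\ldots,a_p$ and $1\le k\le p$, define $\Delta_{\mathbf s}(k)=k(k-1)+\sum_{i=k+1}^{p}\min\{k,a_i\}-\sum_{i=1}^{k}a_i$.
   Formalization: The formal statement assumes n ≥ 2: for n = 1, i.e. D = {2}, the maximum over 1 ≤ k ≤ n−1 defining C* is over an empty set, so C* is undefined (the true value ℓ_q({2}) = 3 would require C* = 2). *)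

theory Defs
  imports Complex_Main
begin

definition simple_graph :: "'a set \<Rightarrow> 'a set set \<Rightarrow> bool" where
  "simple_graph V E \<longleftrightarrow> finite V \<and> (\<forall>e\<in>E. e \<subseteq> V \<and> card e = 2)"

definition degree :: "'a set set \<Rightarrow> 'a \<Rightarrow> nat" where
  "degree E v = card {e \<in> E. v \<in> e}"

definition degree_set :: "'a set \<Rightarrow> 'a set set \<Rightarrow> nat set" where
  "degree_set V E = degree E ` V"

text \<open>Vertices are taken to be natural numbers. This loses nothing, since every finite graph is
  isomorphic to one on natural numbers: see \<open>ell_q_le\<close> and \<open>ell_q_attained\<close> below.\<close>

definition ell_q :: "nat set \<Rightarrow> nat" where
  "ell_q D = (LEAST m. \<exists>(V :: nat set) E. simple_graph V E \<and> degree_set V E = D \<and> card E = m)"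

lemma simple_graph_nat_copy:
  fixes V :: "'a set"
  assumes "simple_graph V E"
  shows "\<exists>(V' :: nat set) E'. simple_graph V' E' \<and> degree_set V' E' = degree_set V E \<and> card E' = card E"
proof -
  have fin: "finite V" and edges: "\<And>e. e \<in> E \<Longrightarrow> e \<subseteq> V \<and> card e = 2"
    using assms by (auto simp: simple_graph_def)
  obtain f :: "'a \<Rightarrow> nat" where f: "inj_on f V"
    using finite_imp_inj_to_nat_seg[OF fin] by blast
  have inj: "inj_on (image f) E"
    by (rule inj_on_subset[OF inj_on_image_Pow[OF f]]) (use edges in auto)
  have deg: "degree (image f ` E) (f v) = degree E v" if "v \<in> V" for v
  proof -
    have "{e \<in> image f ` E. f v \<in> e} = image f ` {e \<in> E. v \<in> e}"
    proof (intro equalityI subsetI)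
      fix e' assume "e' \<in> {e \<in> image f ` E. f v \<in> e}"
      then obtain e where e: "e \<in> E" "e' = f ` e" "f v \<in> f ` e" by blast
      then have "v \<in> e" using edges inj_on_image_mem_iff[OF f that] by simp
      then show "e' \<in> image f ` {e \<in> E. v \<in> e}" using e by simp
    qed auto
    moreover have "inj_on (image f) {e \<in> E. v \<in> e}"
      by (rule inj_on_subset[OF inj]) auto
    ultimately show ?thesis
      by (simp add: degree_def card_image)
  qed
  have "simple_graph (f ` V) (image f ` E)"
    unfolding simple_graph_def
  proof (intro conjI ballI)
    fix e' assume "e' \<in> image f ` E"
    then obtain e where e: "e \<in> E" "e' = f ` e" by blast
    then show "e' \<subseteq> f ` V" using edges by blast
    show "card e' = 2"
      using e edges by (metis card_image f inj_on_subset)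
  qed (use fin in auto)
  moreover have "degree_set (f ` V) (image f ` E) = degree_set V E"
    using deg by (simp add: degree_set_def image_image)
  moreover have "card (image f ` E) = card E"
    using inj by (rule card_image)
  ultimately show ?thesis by blast
qed

lemma ell_q_le:
  fixes V :: "'a set"
  assumes "simple_graph V E"
  shows "ell_q (degree_set V E) \<le> card E"
  unfolding ell_q_def by (rule Least_le) (rule simple_graph_nat_copy[OF assms])

lemma ell_q_attained:
  fixes V :: "'a set"
  assumes "simple_graph V E"
  shows "\<exists>(V' :: nat set) E'. simple_graph V' E' \<and> degree_set V' E' = degree_set V E
           \<and> card E' = ell_q (degree_set V E)"
proof -
  let ?P = "\<lambda>m. \<exists>(V' :: nat set) E'. simple_graph V' E' \<and> degree_set V' E' = degree_set V E \<and> card E' = m"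
  have "?P (card E)" by (rule simple_graph_nat_copy[OF assms])
  then have "?P (Least ?P)" by (rule LeastI)
  then show ?thesis unfolding ell_q_def .
qed

definition sigma :: "nat set \<Rightarrow> nat" where
  "sigma D = \<Sum>D"

text \<open>The term \<open>a\<^sub>i\<close> of the sequence \<open>s = a\<^sub>1, \<dots>, a\<^sub>p\<close> is \<open>s ! (i - 1)\<close>.\<close>

definition Delta :: "nat list \<Rightarrow> nat \<Rightarrow> int" where
  "Delta s k = int k * (int k - 1) + (\<Sum>i = k + 1..length s. int (min k (s ! (i - 1))))
                 - (\<Sum>i = 1..k. int (s ! (i - 1)))"

text \<open>In what follows the set is \<open>{d 1, \<dots>, d n}\<close> with \<open>d 1 > \<dots> > d n\<close>; the value \<open>d 0\<close> plays
  no role.\<close>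

definition last_odd :: "(nat \<Rightarrow> nat) \<Rightarrow> nat \<Rightarrow> nat" where
  "last_odd d n = Max {i \<in> {1..n}. odd (d i)}"

definition seq_even :: "(nat \<Rightarrow> nat) \<Rightarrow> nat \<Rightarrow> nat list" where
  "seq_even d n = map d [1..<n + 1]"

definition seq_odd :: "(nat \<Rightarrow> nat) \<Rightarrow> nat \<Rightarrow> nat list" where
  "seq_odd d n = (let r = last_odd d n in
     map d [1..<r] @ replicate 2 (d r) @ map d [r + 1..<n + 1])"

definition C_star :: "(nat \<Rightarrow> nat) \<Rightarrow> nat \<Rightarrow> int" where
  "C_star d n =
     (if even (sigma (d ` {1..n}))
      then Max ((\<lambda>k. \<lceil>- real_of_int (Delta (seq_even d n) k) / real (min k 2)\<rceil>) ` {1..n - 1})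
      else Max ((\<lambda>k. \<lceil>- real_of_int (Delta (seq_odd d n) k) / real (min k 2)\<rceil>) ` {1..n}))"

end

theory Submission
  imports Defs
begin

text \<open>A graph with degree set \<open>D\<close> contains a vertex of every degree in \<open>D\<close>; if \<open>\<sigma>(D)\<close> is odd, the
  handshake lemma forces a further vertex of odd degree, which is at least \<open>d\<^sub>r\<close>. So the entries of
  \<open>s\<close> are dominated by the degrees of distinct vertices, and all degrees are at least \<open>2\<close>.
  Summing the degrees of the vertices belonging to the first \<open>k\<close> entries shows that \<open>-\<Delta>\<^sub>s(k)\<close> is at
  most \<open>\<Sum> min k (deg v) - \<Sum> min k a\<close> over the other vertices and entries. As \<open>x \<mapsto> min k x\<close> is
  concave, this is at most \<open>min k 2 / 2\<close> times the total excess of the degrees over \<open>s\<close>, which is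
  therefore at least \<open>2 C\<^sup>\<star>\<close>.

  Conversely, appending \<open>C\<^sup>\<star>\<close> copies of \<open>2\<close> to \<open>s\<close> yields a graphic sequence by the Erdos--Gallai
  theorem: for \<open>k < length s\<close> the inequality is the definition of \<open>C\<^sup>\<star>\<close>, and beyond that, where only
  twos follow, \<open>\<Delta>\<close> does not decrease once \<open>k \<ge> 2\<close>.

  The sufficiency half of Erdos--Gallai follows the argument of Tripathi, Venugopalan and West,
  which saturates the vertices one after another by local edge exchanges.\<close>

section \<open>Degree counts in simple graphs\<close>

definition nbrs :: "'a set set \<Rightarrow> 'a \<Rightarrow> 'a set" where
  "nbrs E v = {u. {u, v} \<in> E}"

lemma simple_graph_finite_edges: "simple_graph V E \<Longrightarrow> finite E"
  unfolding simple_graph_def by (rule finite_subset[of _ "Pow V"]) auto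

lemma simple_graph_edgeD:
  assumes "simple_graph V E" and "{a, b} \<in> E"
  shows "a \<in> V" "b \<in> V" "a \<noteq> b"
proof -
  have "{a, b} \<subseteq> V" "card {a, b} = 2" using assms by (auto simp: simple_graph_def)
  then show "a \<in> V" "b \<in> V" "a \<noteq> b" by auto
qed

lemma simple_graph_insert:
  assumes "simple_graph V E" "a \<in> V" "b \<in> V" "a \<noteq> b"
  shows "simple_graph V (insert {a, b} E)"
  using assms by (auto simp: simple_graph_def)

lemma simple_graph_Diff: "simple_graph V E \<Longrightarrow> simple_graph V (E - F)"
  by (auto simp: simple_graph_def)

lemma mem_nbrs_commute: "u \<in> nbrs E v \<longleftrightarrow> v \<in> nbrs E u"
  by (simp add: nbrs_def insert_commute)

lemma nbrs_subset: "simple_graph V E \<Longrightarrow> nbrs E v \<subseteq> V - {v}"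
  by (auto simp: nbrs_def dest: simple_graph_edgeD)

lemma finite_nbrs: "simple_graph V E \<Longrightarrow> finite (nbrs E v)"
  using nbrs_subset by (metis finite_Diff finite_subset simple_graph_def)

lemma degree_eq_card_nbrs:
  assumes "simple_graph V E"
  shows "degree E v = card (nbrs E v)"
proof -
  have "{e \<in> E. v \<in> e} = (\<lambda>u. {u, v}) ` nbrs E v"
  proof (intro equalityI subsetI)
    fix e assume e: "e \<in> {e \<in> E. v \<in> e}"
    then have "card e = 2" using assms by (auto simp: simple_graph_def)
    then obtain a b where "e = {a, b}" by (meson card_2_iff)
    then show "e \<in> (\<lambda>u. {u, v}) ` nbrs E v"
      using e by (auto simp: nbrs_def insert_commute)
  qed (auto simp: nbrs_def)
  moreover have "inj_on (\<lambda>u. {u, v}) (nbrs E v)"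
    by (auto simp: inj_on_def doubleton_eq_iff)
  ultimately show ?thesis by (simp add: degree_def card_image)
qed

lemma degree_insert:
  assumes "finite E" "{a, b} \<notin> E"
  shows "degree (insert {a, b} E) x = degree E x + of_bool (x \<in> {a, b})"
proof -
  have "{e \<in> insert {a, b} E. x \<in> e} =
      (if x \<in> {a, b} then insert {a, b} {e \<in> E. x \<in> e} else {e \<in> E. x \<in> e})" by auto
  then show ?thesis using assms by (simp add: degree_def)
qed

lemma degree_Diff:
  assumes "finite E" "{a, b} \<in> E"
  shows "degree (E - {{a, b}}) x + of_bool (x \<in> {a, b}) = degree E x"
  using degree_insert[of "E - {{a, b}}" a b x] assms by (simp add: insert_absorb)

lemma sum_degree:
  assumes "simple_graph V E"
  shows "(\<Sum>v\<in>V. degree E v) = 2 * card E"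
proof -
  have fin: "finite V" "finite E"
    using assms simple_graph_finite_edges by (auto simp: simple_graph_def)
  have "(\<Sum>v\<in>V. degree E v) = (\<Sum>v\<in>V. \<Sum>e\<in>{e \<in> E. v \<in> e}. 1)"
    by (simp add: degree_def)
  also have "\<dots> = (\<Sum>e\<in>E. \<Sum>v\<in>{v \<in> V. v \<in> e}. (1::nat))"
    by (rule sum.swap_restrict[OF fin])
  also have "\<dots> = (\<Sum>e\<in>E. 2)"
  proof (rule sum.cong)
    fix e assume "e \<in> E"
    then have "{v \<in> V. v \<in> e} = e" "card e = 2" using assms by (auto simp: simple_graph_def)
    then show "(\<Sum>v\<in>{v \<in> V. v \<in> e}. 1) = (2::nat)" by simp
  qed simp
  finally show ?thesis by simp
qed

lemma exists_odd_degree_outside: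
  assumes graph: "simple_graph V E" and "W \<subseteq> V" and "odd (\<Sum>v\<in>W. degree E v)"
  obtains w where "w \<in> V - W" "odd (degree E w)"
proof -
  have "(\<Sum>v\<in>V. degree E v) = (\<Sum>v\<in>V - W. degree E v) + (\<Sum>v\<in>W. degree E v)"
    by (rule sum.subset_diff) (use assms(2) graph in \<open>auto simp: simple_graph_def\<close>)
  then have "odd (\<Sum>v\<in>V - W. degree E v)"
    using sum_degree[OF graph] assms(3) by (metis dvd_triv_left even_add)
  then have "\<exists>w\<in>V - W. odd (degree E w)" by (meson dvd_sum)
  then show thesis using that by blast
qed

lemma sum_card_nbrs_swap:
  assumes "finite A" "finite B"
  shows "(\<Sum>v\<in>A. card (nbrs E v \<inter> B)) = (\<Sum>v\<in>B. card (nbrs E v \<inter> A))"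
proof -
  have "(\<Sum>v\<in>A. card (nbrs E v \<inter> B)) = (\<Sum>v\<in>A. \<Sum>u\<in>{u \<in> B. {u, v} \<in> E}. 1)"
    by (intro sum.cong) (auto simp: nbrs_def intro!: arg_cong[where f = card])
  also have "\<dots> = (\<Sum>u\<in>B. \<Sum>v\<in>{v \<in> A. {u, v} \<in> E}. 1)"
    by (rule sum.swap_restrict) (use assms in auto)
  also have "\<dots> = (\<Sum>v\<in>B. card (nbrs E v \<inter> A))"
    by (intro sum.cong) (auto simp: nbrs_def insert_commute intro!: arg_cong[where f = card])
  finally show ?thesis .
qed

lemma sum_degree_split:
  assumes graph: "simple_graph V E" and "K \<subseteq> V"
  shows "(\<Sum>v\<in>K. degree E v) =
    (\<Sum>v\<in>K. card (nbrs E v \<inter> K)) + (\<Sum>v\<in>V - K. card (nbrs E v \<inter> K))"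
proof -
  have fin: "finite K" "finite (V - K)"
    using assms finite_subset by (auto simp: simple_graph_def)
  have "degree E v = card (nbrs E v \<inter> K) + card (nbrs E v \<inter> (V - K))" for v
  proof -
    have "nbrs E v = (nbrs E v \<inter> K) \<union> (nbrs E v \<inter> (V - K))" using nbrs_subset[OF graph] by blast
    moreover have "card \<dots> = card (nbrs E v \<inter> K) + card (nbrs E v \<inter> (V - K))"
      by (rule card_Un_disjoint) (use fin in auto)
    ultimately show ?thesis using degree_eq_card_nbrs[OF graph] by metis
  qed
  then show ?thesis by (simp add: sum.distrib sum_card_nbrs_swap[OF fin])
qed

lemma sum_degree_le:
  assumes graph: "simple_graph V E" and "K \<subseteq> V"
  shows "(\<Sum>v\<in>K. degree E v) \<le> card K * (card K - 1) + (\<Sum>v\<in>V - K. min (card K) (degree E v))"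
proof -
  have fin: "finite K" using assms finite_subset by (auto simp: simple_graph_def)
  have "card (nbrs E v \<inter> K) \<le> card K - 1" if "v \<in> K" for v
  proof -
    have "nbrs E v \<inter> K \<subseteq> K - {v}" using nbrs_subset[OF graph] by blast
    then have "card (nbrs E v \<inter> K) \<le> card (K - {v})" using fin by (intro card_mono) auto
    then show ?thesis using that fin by simp
  qed
  then have "(\<Sum>v\<in>K. card (nbrs E v \<inter> K)) \<le> (\<Sum>v\<in>K. card K - 1)" by (rule sum_mono)
  moreover have "(\<Sum>v\<in>V - K. card (nbrs E v \<inter> K)) \<le> (\<Sum>v\<in>V - K. min (card K) (degree E v))"
    by (rule sum_mono)
      (auto simp: degree_eq_card_nbrs[OF graph] fin finite_nbrs[OF graph] intro!: card_mono)
  ultimately show ?thesis unfolding sum_degree_split[OF assms] by simp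
qed

lemma exists_private_nbr:
  assumes graph: "simple_graph V E" and less: "degree E r < degree E i"
  obtains u where "{u, i} \<in> E" "{u, r} \<notin> E" "u \<noteq> r" "u \<noteq> i"
proof -
  have "card (nbrs E r - {i}) < card (nbrs E i - {r})"
  proof (cases "i \<in> nbrs E r")
    case True
    then have "0 < card (nbrs E r)" using finite_nbrs[OF graph] card_gt_0_iff by blast
    then show ?thesis using True less mem_nbrs_commute[of i E r]
      by (simp add: degree_eq_card_nbrs[OF graph])
  next
    case False
    then show ?thesis using less mem_nbrs_commute[of i E r]
      by (simp add: degree_eq_card_nbrs[OF graph])
  qed
  then have "\<not> nbrs E i - {r} \<subseteq> nbrs E r - {i}"
    using card_mono finite_nbrs[OF graph] by (metis finite_Diff not_less)
  then show thesis using that nbrs_subset[OF graph] by (auto simp: nbrs_def)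
qed

section \<open>Sufficiency of the Erdos--Gallai inequalities\<close>

text \<open>The vertices of \<open>S\<close> are saturated and \<open>r\<close> is the next one to saturate. That \<open>insert r S\<close>
  covers all edges is what bounds the remaining degrees by \<open>card (insert r S)\<close>.\<close>

definition subrealization ::
    "'a set \<Rightarrow> ('a \<Rightarrow> nat) \<Rightarrow> 'a set \<Rightarrow> 'a \<Rightarrow> 'a set set \<Rightarrow> bool" where
  "subrealization V f S r E \<longleftrightarrow> simple_graph V E \<and> (\<forall>v\<in>V. degree E v \<le> f v) \<and>
     (\<forall>v\<in>S. degree E v = f v) \<and> (\<forall>e\<in>E. e \<inter> insert r S \<noteq> {})"

locale stuck_subrealization =
  fixes V :: "'a set" and f :: "'a \<Rightarrow> nat" and S :: "'a set" and r :: 'a and E :: "'a set set"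
  assumes subrealization: "subrealization V f S r E"
    and maximal: "\<And>E'. subrealization V f S r E' \<Longrightarrow> degree E' r \<le> degree E r"
    and deficient: "degree E r < f r"
    and S_subset: "S \<subseteq> V" and r_in: "r \<in> V" and r_notin: "r \<notin> S"
    and f_r_le: "\<And>v. v \<in> S \<Longrightarrow> f r \<le> f v"
    and even_sum: "even (\<Sum>v\<in>V. f v)"
begin

abbreviation rest :: "'a set" where
  "rest \<equiv> V - insert r S"

lemma graph: "simple_graph V E"
  and degree_le: "v \<in> V \<Longrightarrow> degree E v \<le> f v"
  and degree_saturated: "v \<in> S \<Longrightarrow> degree E v = f v"
  and edge_covered: "e \<in> E \<Longrightarrow> e \<inter> insert r S \<noteq> {}"
  using subrealization by (auto simp: subrealization_def)

lemmas finite_edges = simple_graph_finite_edges[OF graph]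

lemmas edgeD = simple_graph_edgeD[OF graph]

lemma finite_V: "finite V"
  using graph by (simp add: simple_graph_def)

lemma degree_r_less: "v \<in> S \<Longrightarrow> degree E r < degree E v"
  using f_r_le[of v] deficient by (simp add: degree_saturated)

lemma no_improvement:
  assumes "simple_graph V E'"
    and "\<And>v. v \<in> V \<Longrightarrow> degree E' v \<le> f v" and "\<And>v. v \<in> S \<Longrightarrow> degree E' v = degree E v"
    and "\<And>e. e \<in> E' \<Longrightarrow> e \<inter> insert r S \<noteq> {}" and "degree E r < degree E' r"
  shows False
proof -
  have "subrealization V f S r E'" using assms by (simp add: subrealization_def degree_saturated)
  then show False using maximal assms(5) by fastforce
qed

lemma rest_deficient_adjacent:
  assumes "w \<in> rest" "degree E w < f w"
  shows "{w, r} \<in> E"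
proof (rule ccontr)
  assume nonadj: "{w, r} \<notin> E"
  have deg: "degree (insert {w, r} E) v = degree E v + of_bool (v \<in> {w, r})" for v
    using degree_insert[OF finite_edges nonadj] .
  show False
  proof (rule no_improvement)
    show "simple_graph V (insert {w, r} E)"
      using assms r_in by (intro simple_graph_insert graph) auto
    show "degree (insert {w, r} E) v \<le> f v" if "v \<in> V" for v
      using assms deficient degree_le[OF that] by (auto simp: deg)
  qed (use assms r_notin edge_covered in \<open>auto simp: deg\<close>)
qed

text \<open>A neighbour \<open>u\<close> of \<open>i\<close> not adjacent to \<open>r\<close> trades its edge to \<open>i\<close> for one to \<open>r\<close>, and
  the new edge \<open>{i, x}\<close> restores the degree of \<open>i\<close>.\<close>

lemma edge_exchange:
  assumes i: "i \<in> S" and x: "x \<in> V" "x \<noteq> i" and nonadj: "{i, x} \<notin> E"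
  obtains E' where "simple_graph V E'"
    "\<And>v. degree E' v = degree E v + of_bool (v = r) + of_bool (v = x)"
    "\<And>e. e \<in> E' \<Longrightarrow> e \<inter> insert r S \<noteq> {}" "{e \<in> E. i \<notin> e} \<subseteq> E'"
proof -
  obtain u where u: "{u, i} \<in> E" "{u, r} \<notin> E" "u \<noteq> r" "u \<noteq> i"
    using exists_private_nbr[OF graph degree_r_less[OF i]] by blast
  have i_neq_r: "i \<noteq> r" using i r_notin by blast
  define F where "F = insert {u, r} (E - {{u, i}})"
  have deg_F: "degree F v + of_bool (v = i) = degree E v + of_bool (v = r)" for v
    using degree_Diff[OF finite_edges u(1), of v] degree_insert[of "E - {{u, i}}" u r v]
      finite_edges u i_neq_r by (auto simp: F_def of_bool_def)
  have "{i, x} \<notin> F" "finite F"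
    using u x nonadj i_neq_r finite_edges by (auto simp: F_def doubleton_eq_iff)
  then have deg: "degree (insert {i, x} F) v = degree E v + of_bool (v = r) + of_bool (v = x)" for v
    using deg_F[of v] degree_insert[of F i x v] x(2) by (auto simp: of_bool_def split: if_splits)
  show thesis
  proof (rule that[OF _ deg])
    show "simple_graph V (insert {i, x} F)"
      unfolding F_def using edgeD[OF u(1)] x u(3) r_in
      by (intro simple_graph_insert simple_graph_Diff graph) auto
    show "e \<inter> insert r S \<noteq> {}" if "e \<in> insert {i, x} F" for e
      using that i edge_covered by (auto simp: F_def)
  qed (auto simp: F_def)
qed

lemma saturated_adjacent_if_room:
  assumes "i \<in> S" "x \<in> V - S" and room: "degree E x + of_bool (x = r) < f x"
  shows "{i, x} \<in> E"
proof (rule ccontr)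
  assume nonadj: "{i, x} \<notin> E"
  obtain E' where E': "simple_graph V E'"
      "\<And>v. degree E' v = degree E v + of_bool (v = r) + of_bool (v = x)"
      "\<And>e. e \<in> E' \<Longrightarrow> e \<inter> insert r S \<noteq> {}" "{e \<in> E. i \<notin> e} \<subseteq> E'"
    by (rule edge_exchange[OF assms(1) _ _ nonadj]) (use assms in auto)
  show False
  proof (rule no_improvement[OF E'(1) _ _ E'(3)])
    show "degree E' v \<le> f v" if "v \<in> V" for v
      using room deficient degree_le[OF that] by (auto simp: E'(2))
  qed (use assms r_notin in \<open>auto simp: E'(2)\<close>)
qed

lemma saturated_adjacent_if_rest_nbr:
  assumes "i \<in> S" "x \<in> insert r S" "x \<noteq> i" "w \<in> rest" "{w, x} \<in> E"
  shows "{i, x} \<in> E"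
proof (rule ccontr)
  assume nonadj: "{i, x} \<notin> E"
  obtain E' where E': "simple_graph V E'"
      "\<And>v. degree E' v = degree E v + of_bool (v = r) + of_bool (v = x)"
      "\<And>e. e \<in> E' \<Longrightarrow> e \<inter> insert r S \<noteq> {}" "{e \<in> E. i \<notin> e} \<subseteq> E'"
    by (rule edge_exchange[OF assms(1) _ assms(3) nonadj]) (use assms(2) S_subset r_in in auto)
  have wx_in: "{w, x} \<in> E'" using E'(4) assms by auto
  have deg: "degree (E' - {{w, x}}) v + of_bool (v = w) = degree E v + of_bool (v = r)" for v
    using degree_Diff[OF simple_graph_finite_edges[OF E'(1)] wx_in, of v] assms
    by (auto simp: E'(2) of_bool_def split: if_splits)
  show False
  proof (rule no_improvement)
    show "simple_graph V (E' - {{w, x}})" by (rule simple_graph_Diff[OF E'(1)])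
    show "degree (E' - {{w, x}}) v \<le> f v" if "v \<in> V" for v
      using deg[of v] degree_le[OF that] deficient by (cases "v = r") auto
    show "degree (E' - {{w, x}}) v = degree E v" if "v \<in> S" for v
      using deg[of v] that assms(4) r_notin by (auto simp: of_bool_def split: if_splits)
    show "degree E r < degree (E' - {{w, x}}) r"
      using deg[of r] assms(4) by (auto simp: of_bool_def split: if_splits)
  qed (use E'(3) in auto)
qed

lemma saturated_adjacent_r:
  assumes "i \<in> S"
  shows "{i, r} \<in> E"
proof (cases "\<exists>w\<in>rest. degree E w < f w")
  case True
  then obtain w where "w \<in> rest" "degree E w < f w" by blast
  then show ?thesis
    using saturated_adjacent_if_rest_nbr[OF assms, of r w] rest_deficient_adjacent assms r_notin
    by blast
next
  case False
  then have "f v = degree E v" if "v \<in> V - {r}" for v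
    using that degree_le[of v] degree_saturated[of v] by force
  then have "(\<Sum>v\<in>V. f v) + degree E r = (\<Sum>v\<in>V. degree E v) + f r"
    using r_in finite_V by (simp add: sum.remove[of V r])
  then have "even (degree E r + f r)"
    using even_sum sum_degree[OF graph] by (metis dvd_triv_left even_add)
  then have "degree E r + 2 \<le> f r" using deficient by presburger
  then show ?thesis using saturated_adjacent_if_room[OF assms, of r] r_in r_notin by simp
qed

lemma insert_r_S_clique:
  assumes "a \<in> insert r S" "b \<in> insert r S" "a \<noteq> b"
  shows "{a, b} \<in> E"
proof (cases "a = r \<or> b = r")
  case True
  then show ?thesis using assms saturated_adjacent_r by (auto simp: insert_commute)
next
  case False
  then have in_S: "a \<in> S" "b \<in> S" using assms by auto
  obtain w where w: "{w, b} \<in> E" "{w, r} \<notin> E" "w \<noteq> r"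
    using exists_private_nbr[OF graph degree_r_less[OF in_S(2)]] by blast
  then have "w \<in> rest" using saturated_adjacent_r edgeD[OF w(1)] by blast
  then show ?thesis using saturated_adjacent_if_rest_nbr in_S w(1) assms by blast
qed

lemma rest_nbrs_subset:
  assumes "v \<in> rest"
  shows "nbrs E v \<subseteq> insert r S"
  using edge_covered assms by (fastforce simp: nbrs_def)

lemma rest_degree:
  assumes "v \<in> rest"
  shows "degree E v = min (card (insert r S)) (f v)"
proof (cases "degree E v < f v")
  case True
  then have "insert r S \<subseteq> nbrs E v"
    using saturated_adjacent_if_room[of _ v] rest_deficient_adjacent[OF assms] assms
    by (auto simp: nbrs_def insert_commute)
  then have "nbrs E v = insert r S" using rest_nbrs_subset[OF assms] by blast
  then show ?thesis using True by (simp add: degree_eq_card_nbrs[OF graph])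
next
  case False
  then have "degree E v = f v" using degree_le[of v] assms by simp
  moreover have "degree E v \<le> card (insert r S)"
    unfolding degree_eq_card_nbrs[OF graph]
    by (rule card_mono[OF _ rest_nbrs_subset[OF assms]])
      (use S_subset finite_V finite_subset in auto)
  ultimately show ?thesis by simp
qed

lemma Erdos_Gallai_violated:
  defines "K \<equiv> insert r S"
  shows "card K * (card K - 1) + (\<Sum>v\<in>V - K. min (card K) (f v)) < (\<Sum>v\<in>K. f v)"
proof -
  have K: "K \<subseteq> V" using S_subset r_in by (simp add: K_def)
  have "nbrs E v \<inter> K = K - {v}" if "v \<in> K" for v
    using insert_r_S_clique that nbrs_subset[OF graph] by (auto simp: K_def nbrs_def)
  moreover have "card (nbrs E v \<inter> K) = min (card K) (f v)" if "v \<in> V - K" for v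
    using rest_degree[of v] rest_nbrs_subset[of v] that
    by (simp add: K_def Int_absorb2 degree_eq_card_nbrs[OF graph])
  ultimately have "(\<Sum>v\<in>K. degree E v) = card K * (card K - 1) + (\<Sum>v\<in>V - K. min (card K) (f v))"
    using sum_degree_split[OF graph K] by simp
  moreover have "(\<Sum>v\<in>K. degree E v) < (\<Sum>v\<in>K. f v)"
    by (rule sum_strict_mono_ex1)
      (use K finite_V finite_subset degree_le deficient in \<open>auto simp: K_def\<close>)
  ultimately show ?thesis by simp
qed

end

lemma subrealization_saturate:
  assumes "subrealization V f S r E" and "S \<subseteq> V" "r \<in> V" "r \<notin> S"
    and "\<And>v. v \<in> S \<Longrightarrow> f r \<le> f v" and "even (\<Sum>v\<in>V. f v)"
    and Erdos_Gallai: "(\<Sum>v\<in>insert r S. f v) \<le> card (insert r S) * (card (insert r S) - 1) +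
      (\<Sum>v\<in>V - insert r S. min (card (insert r S)) (f v))"
  obtains E' where "subrealization V f (insert r S) q E'"
proof -
  have "\<forall>E'. subrealization V f S r E' \<longrightarrow> degree E' r < Suc (f r)"
    using \<open>r \<in> V\<close> by (simp add: subrealization_def less_Suc_eq_le)
  then obtain E' where E': "subrealization V f S r E'"
      "\<And>E''. subrealization V f S r E'' \<Longrightarrow> degree E'' r \<le> degree E' r"
    using ex_has_greatest_nat[of "subrealization V f S r" E "\<lambda>E. degree E r"] assms(1) by blast
  have "degree E' r = f r"
  proof (rule ccontr)
    assume "degree E' r \<noteq> f r"
    then have "degree E' r < f r"
      using E'(1) \<open>r \<in> V\<close> by (simp add: subrealization_def nat_less_le)
    then interpret stuck_subrealization V f S r E'
      using E' assms by unfold_locales auto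
    show False using Erdos_Gallai_violated Erdos_Gallai by simp
  qed
  then have "subrealization V f (insert r S) q E'"
    using E'(1) by (auto simp: subrealization_def)
  then show thesis by (rule that)
qed

lemma Delta_eq_sum_nth:
  "Delta s k = int k * (int k - 1) + (\<Sum>i = k..<length s. int (min k (s ! i))) - (\<Sum>i<k. int (s ! i))"
proof -
  have "(\<Sum>i = k + 1..length s. int (min k (s ! (i - 1)))) =
      (\<Sum>i = k..<length s. int (min k (s ! i)))"
    using sum.atLeast_Suc_lessThan_Suc_shift[of "\<lambda>i. int (min k (s ! (i - 1)))" k "length s"]
    by (simp add: atLeastLessThanSuc_atLeastAtMost)
  moreover have "(\<Sum>i = 1..k. int (s ! (i - 1))) = (\<Sum>i<k. int (s ! i))"
    using sum.atLeast1_atMost_eq[of "\<lambda>i. int (s ! (i - 1))" k] by simp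
  ultimately show ?thesis by (simp add: Delta_def)
qed

lemma Delta_eq_sum_list:
  assumes "k \<le> length s"
  shows "Delta s k = int k * (int k - 1) + (\<Sum>a\<leftarrow>drop k s. int (min k a)) - (\<Sum>a\<leftarrow>take k s. int a)"
proof -
  have "(\<Sum>a\<leftarrow>drop k s. int (min k a)) = (\<Sum>i = k..<length s. int (min k (s ! i)))"
    using assms sum.shift_bounds_nat_ivl[of "\<lambda>i. int (min k (s ! i))" 0 k "length s - k"]
    by (simp add: sum_list_sum_nth add.commute)
  moreover have "(\<Sum>a\<leftarrow>take k s. int a) = (\<Sum>i<k. int (s ! i))"
    using assms by (simp add: sum_list_sum_nth atLeast0LessThan min_absorb2)
  ultimately show ?thesis by (simp add: Delta_eq_sum_nth)
qed

theorem Erdos_Gallai_sufficient: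
  assumes sorted: "sorted_wrt (\<ge>) s" and even: "even (sum_list s)"
    and Delta_nonneg: "\<And>k. 1 \<le> k \<Longrightarrow> k \<le> length s \<Longrightarrow> 0 \<le> Delta s k"
  obtains E where "simple_graph {..<length s} E" "\<And>i. i < length s \<Longrightarrow> degree E i = s ! i"
proof -
  let ?V = "{..<length s}"
  have "\<exists>E. subrealization ?V ((!) s) {..<r} r E" if "r \<le> length s" for r
    using that
  proof (induction r)
    case 0
    have "subrealization ?V ((!) s) {..<0} 0 {}"
      by (simp add: subrealization_def simple_graph_def degree_def)
    then show ?case by blast
  next
    case (Suc r)
    then obtain E where E: "subrealization ?V ((!) s) {..<r} r E" by auto
    have intervals: "insert r {..<r} = {..<Suc r}" "?V - {..<Suc r} = {Suc r..<length s}" by auto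
    have "int (\<Sum>i<Suc r. s ! i) \<le>
        int (Suc r * (Suc r - 1) + (\<Sum>i = Suc r..<length s. min (Suc r) (s ! i)))"
      using Delta_nonneg[of "Suc r"] Suc.prems unfolding Delta_eq_sum_nth
      by (simp add: algebra_simps)
    then have "(\<Sum>i<Suc r. s ! i) \<le>
        Suc r * (Suc r - 1) + (\<Sum>i = Suc r..<length s. min (Suc r) (s ! i))"
      by (simp only: of_nat_le_iff)
    moreover have "s ! r \<le> s ! i" if "i < r" for i
      using sorted_wrt_nth_less[OF sorted that] Suc.prems by simp
    ultimately obtain E' where "subrealization ?V ((!) s) {..<Suc r} (Suc r) E'"
      using subrealization_saturate[OF E, of "Suc r"] Suc.prems even
      by (auto simp only: intervals card_lessThan sum_list_sum_nth atLeast0LessThan) auto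
    then show ?case by blast
  qed
  then obtain E where "subrealization ?V ((!) s) ?V (length s) E" by blast
  then show thesis by (intro that[of E]) (auto simp: subrealization_def)
qed

section \<open>Completing a sequence by twos\<close>

lemma Delta_append_replicate:
  assumes "k \<le> length s"
  shows "Delta (s @ replicate c x) k = Delta s k + int c * int (min k x)"
  using assms by (simp add: Delta_eq_sum_list sum_list_replicate)

lemma Delta_le_Suc:
  assumes "k < length s" "s ! k \<le> k"
  shows "Delta s k \<le> Delta s (Suc k)"
proof -
  have drop: "drop k s = s ! k # drop (Suc k) s"
    using assms(1) by (rule Cons_nth_drop_Suc[symmetric])
  have "(\<Sum>a\<leftarrow>drop (Suc k) s. int (min k a)) \<le> (\<Sum>a\<leftarrow>drop (Suc k) s. int (min (Suc k) a))"
    by (rule sum_list_mono) simp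
  then show ?thesis
    using assms by (simp add: Delta_eq_sum_list drop take_Suc_conv_app_nth algebra_simps)
qed

lemma Delta_mono_tail:
  assumes "k \<le> m" "m \<le> length s" "\<And>i. k \<le> i \<Longrightarrow> i < m \<Longrightarrow> s ! i \<le> i"
  shows "Delta s k \<le> Delta s m"
  using assms
proof (induction m rule: dec_induct)
  case (step m)
  then show ?case using Delta_le_Suc[of m s] by fastforce
qed simp

definition twos_needed :: "nat list \<Rightarrow> int" where
  "twos_needed s = Max ((\<lambda>k. \<lceil>- real_of_int (Delta s k) / real (min k 2)\<rceil>) ` {1..length s - 1})"

lemma twos_needed_le_iff:
  assumes "2 \<le> length s"
  shows "twos_needed s \<le> m \<longleftrightarrow> (\<forall>k\<in>{1..length s - 1}. - Delta s k \<le> m * int (min k 2))"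
proof -
  have "\<lceil>- real_of_int (Delta s k) / real (min k 2)\<rceil> \<le> m \<longleftrightarrow> - Delta s k \<le> m * int (min k 2)"
    if "1 \<le> k" for k
  proof -
    have "- real_of_int (Delta s k) / real (min k 2) \<le> real_of_int m \<longleftrightarrow>
        real_of_int (- Delta s k) \<le> real_of_int (m * int (min k 2))"
      using that by (subst pos_divide_le_eq) auto
    then show ?thesis by (simp only: ceiling_le_iff of_int_le_iff)
  qed
  then show ?thesis unfolding twos_needed_def using assms by (subst Max_le_iff) auto
qed

lemma twos_needed_nonneg:
  assumes "2 \<le> length s" "length s \<le> Suc (hd s)" "\<And>x. x \<in> set s \<Longrightarrow> 0 < x"
  shows "0 \<le> twos_needed s"
proof -
  obtain a t where s: "s = a # t" using assms(1) by (cases s) auto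
  have "(\<Sum>x\<leftarrow>t. int (min (Suc 0) x)) = (\<Sum>x\<leftarrow>t. 1)"
    using assms(3)
    by (intro arg_cong[where f = sum_list] map_cong) (auto simp: s min_absorb1 Suc_le_eq)
  then have "Delta s 1 = int (length t) - int a"
    by (simp add: Delta_eq_sum_list s sum_list_triv)
  then have "Delta s 1 \<le> 0" using assms(2) by (simp add: s)
  moreover have "- Delta s 1 \<le> twos_needed s * int (min 1 2)"
    by (rule bspec[OF iffD1[OF twos_needed_le_iff[OF assms(1)] order_refl]]) (use assms(1) in auto)
  ultimately show ?thesis by simp
qed

text \<open>Across a two \<open>Delta\<close> may decrease only from \<open>k = 1\<close> to \<open>k = 2\<close>, and this step lies beyond the
  range of \<open>twos_needed\<close> only for \<open>length s = 2\<close>.\<close>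

lemma Delta_append_twos_nonneg:
  assumes sorted: "sorted_wrt (\<ge>) s" and len: "2 \<le> length s" and last: "last s = 2"
    and enough: "twos_needed s \<le> int c" and k: "1 \<le> k" "k \<le> length s + c"
  shows "0 \<le> Delta (s @ replicate c 2) k"
proof -
  let ?t = "s @ replicate c 2"
  let ?L = "length s - 1"
  have low: "0 \<le> Delta ?t k" if "1 \<le> k" "k \<le> ?L" for k
  proof -
    have "- Delta s k \<le> int c * int (min k 2)" using enough twos_needed_le_iff[OF len] that by simp
    then show ?thesis using that by (simp add: Delta_append_replicate)
  qed
  have start: "0 \<le> Delta ?t (max 2 ?L)"
  proof (cases "length s = 2")
    case True
    then obtain a where s: "s = [a, 2]"
      using last by (auto simp: length_Suc_conv numeral_2_eq_2)
    have "2 \<le> a" using sorted by (simp add: s)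
    moreover have "Delta ?t 1 = 1 + int c - int a" "Delta ?t 2 = 2 * int c - int a"
      by (simp_all add: Delta_eq_sum_list s sum_list_replicate numeral_2_eq_2)
    ultimately show ?thesis using low[of 1] by (simp add: s numeral_2_eq_2)
  next
    case False
    then have "2 \<le> ?L" using len by linarith
    then show ?thesis using low[of ?L] by (simp add: max_absorb2)
  qed
  have "s ! ?L = 2" using last len by (subst last_conv_nth[symmetric]) auto
  then have "?t ! i = 2" if "?L \<le> i" "i < length s + c" for i
    using that len by (cases "i = ?L") (auto simp: nth_append)
  then have "Delta ?t (max 2 ?L) \<le> Delta ?t k" if "max 2 ?L \<le> k"
    using that k by (intro Delta_mono_tail) auto
  moreover consider "k \<le> ?L" | "max 2 ?L \<le> k" using len by linarith
  ultimately show ?thesis using start low k(1) by cases (blast, force)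
qed

lemma sorted_wrt_ge_last_le:
  fixes s :: "'a::preorder list"
  shows "sorted_wrt (\<ge>) s \<Longrightarrow> x \<in> set s \<Longrightarrow> last s \<le> x"
  by (induction s) auto

lemma exists_graph_twos_needed:
  assumes sorted: "sorted_wrt (\<ge>) s" and len: "2 \<le> length s" and last: "last s = 2"
    and even: "even (sum_list s)" and nonneg: "0 \<le> twos_needed s"
  obtains E where "simple_graph {..<length s + nat (twos_needed s)} E"
    "degree_set {..<length s + nat (twos_needed s)} E = set s"
    "2 * int (card E) = int (sum_list s) + 2 * twos_needed s"
proof -
  define c where "c = nat (twos_needed s)"
  define t where "t = s @ replicate c 2"
  have needed: "twos_needed s = int c" using nonneg by (simp add: c_def)
  have "2 \<le> x" if "x \<in> set s" for x
    using sorted_wrt_ge_last_le[OF sorted that] last by simp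
  moreover have "sorted_wrt (\<ge>) (replicate c (2::nat))" by (simp add: sorted_wrt_iff_nth_less)
  ultimately have "sorted_wrt (\<ge>) t" using sorted by (simp add: t_def sorted_wrt_append)
  moreover have "0 \<le> Delta t k" if "1 \<le> k" "k \<le> length t" for k
    using Delta_append_twos_nonneg[OF sorted len last _ that(1), of c] that(2) needed
    by (simp add: t_def)
  moreover have "even (sum_list t)" using even by (simp add: t_def sum_list_replicate)
  ultimately obtain E where E: "simple_graph {..<length t} E"
      "\<And>i. i < length t \<Longrightarrow> degree E i = t ! i"
    using Erdos_Gallai_sufficient by blast
  have "degree_set {..<length t} E = set t"
    using E(2) by (auto simp: degree_set_def set_conv_nth)
  also have "\<dots> = set s"
    using last_in_set[of s] last len by (cases "s = []") (auto simp: t_def)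
  finally have "degree_set {..<length t} E = set s" .
  moreover have "(\<Sum>i<length t. degree E i) = sum_list t"
    using E(2) by (simp add: sum_list_sum_nth atLeast0LessThan)
  then have "2 * card E = sum_list s + 2 * c"
    using sum_degree[OF E(1)] by (simp add: t_def sum_list_replicate)
  ultimately show thesis
    using that[of E] E(1) needed by (simp add: t_def)
qed

section \<open>Lower bound on the number of edges\<close>

definition dominates :: "'a set \<Rightarrow> 'a set set \<Rightarrow> nat list \<Rightarrow> bool" where
  "dominates V E s \<longleftrightarrow>
     (\<exists>vs. distinct vs \<and> set vs \<subseteq> V \<and> list_all2 (\<lambda>a v. a \<le> degree E v) s vs)"

lemma sum_list_mono_list_all2:
  fixes f :: "'a \<Rightarrow> 'c::ordered_comm_monoid_add" and g :: "'b \<Rightarrow> 'c"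
  assumes "list_all2 P xs ys" "\<And>x y. x \<in> set xs \<Longrightarrow> P x y \<Longrightarrow> f x \<le> g y"
  shows "(\<Sum>x\<leftarrow>xs. f x) \<le> (\<Sum>y\<leftarrow>ys. g y)"
  using assms by (induction rule: list_all2_induct) (auto intro!: add_mono)

text \<open>The map \<open>x \<mapsto> min k x\<close> is concave, so beyond \<open>\<delta>\<close> its slope is at most
  \<open>min k \<delta> / \<delta>\<close>.\<close>

lemma scaled_minus_min_mono:
  fixes a b k \<delta> :: nat
  assumes "\<delta> \<le> a" "a \<le> b"
  shows "int (min k \<delta>) * int a - int \<delta> * int (min k a) \<le>
    int (min k \<delta>) * int b - int \<delta> * int (min k b)"
proof (cases "k \<le> \<delta>")
  case True
  then show ?thesis using assms by (simp add: min_absorb1 mult_left_mono)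
next
  case False
  have "int a - int (min k a) \<le> int b - int (min k b)" using assms by simp
  then have "int \<delta> * (int a - int (min k a)) \<le> int \<delta> * (int b - int (min k b))"
    by (rule mult_left_mono) simp
  then show ?thesis using False by (simp add: min_absorb2 algebra_simps)
qed

lemma scaled_sum_min_diff_le:
  fixes f :: "'a \<Rightarrow> nat" and k \<delta> :: nat
  assumes "list_all2 (\<lambda>a v. a \<le> f v) xs vs" and "\<And>a. a \<in> set xs \<Longrightarrow> \<delta> \<le> a"
  shows "int \<delta> * ((\<Sum>v\<leftarrow>vs. int (min k (f v))) - (\<Sum>a\<leftarrow>xs. int (min k a))) \<le>
    int (min k \<delta>) * ((\<Sum>v\<leftarrow>vs. int (f v)) - (\<Sum>a\<leftarrow>xs. int a))"
proof -
  have "(\<Sum>a\<leftarrow>xs. int (min k \<delta>) * int a - int \<delta> * int (min k a)) \<le>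
      (\<Sum>v\<leftarrow>vs. int (min k \<delta>) * int (f v) - int \<delta> * int (min k (f v)))"
    by (rule sum_list_mono_list_all2[OF assms(1)]) (rule scaled_minus_min_mono[OF assms(2)])
  then show ?thesis
    by (simp add: sum_list_subtractf sum_list_const_mult right_diff_distrib)
qed

lemma sum_list_degree_le:
  assumes graph: "simple_graph V E" and vs: "distinct vs" "set vs \<subseteq> V" and k: "k \<le> length vs"
  shows "(\<Sum>v\<leftarrow>take k vs. int (degree E v)) \<le> int k * (int k - 1)
    + (\<Sum>v\<leftarrow>drop k vs. int (min k (degree E v))) + (\<Sum>v\<in>V - set vs. int (min k (degree E v)))"
proof -
  let ?K = "set (take k vs)"
  have fin: "finite V" using graph by (simp add: simple_graph_def)
  have K: "?K \<subseteq> V" "card ?K = k"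
    using vs k by (auto simp: distinct_card dest: in_set_takeD)
  have complement: "V - ?K = set (drop k vs) \<union> (V - set vs)"
    using vs set_take_disj_set_drop_if_distinct[of vs k k] set_append[of "take k vs" "drop k vs"]
    by auto
  have "int (\<Sum>v\<in>?K. degree E v) \<le> int (k * (k - 1) + (\<Sum>v\<in>V - ?K. min k (degree E v)))"
    using sum_degree_le[OF graph K(1)] K(2) by (simp only: of_nat_le_iff)
  also have "\<dots> = int k * (int k - 1) + (\<Sum>v\<in>V - ?K. int (min k (degree E v)))"
    by (cases k) (simp_all add: algebra_simps)
  also have "(\<Sum>v\<in>V - ?K. int (min k (degree E v))) =
      (\<Sum>v\<in>set (drop k vs). int (min k (degree E v))) + (\<Sum>v\<in>V - set vs. int (min k (degree E v)))"
    unfolding complement by (rule sum.union_disjoint) (use fin in \<open>auto dest: in_set_dropD\<close>)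
  finally show ?thesis using vs(1) by (simp add: sum_list_distinct_conv_sum_set)
qed

lemma twice_card_edges_eq_sum_list_degree:
  assumes graph: "simple_graph V E" and vs: "distinct vs" "set vs \<subseteq> V"
  shows "2 * int (card E) = (\<Sum>v\<leftarrow>vs. int (degree E v)) + (\<Sum>v\<in>V - set vs. int (degree E v))"
proof -
  have "2 * int (card E) = int (\<Sum>v\<in>V. degree E v)" using sum_degree[OF graph] by simp
  also have "\<dots> = int (\<Sum>v\<in>V - set vs. degree E v) + int (\<Sum>v\<in>set vs. degree E v)"
    using vs(2) graph by (simp add: sum.subset_diff simple_graph_def)
  finally show ?thesis using vs(1) by (simp add: sum_list_distinct_conv_sum_set)
qed

lemma minus_Delta_le_card_edges:
  assumes graph: "simple_graph V E" and dom: "dominates V E s"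
    and deg_ge: "\<And>v. v \<in> V \<Longrightarrow> \<delta> \<le> degree E v" and s_ge: "\<And>a. a \<in> set s \<Longrightarrow> \<delta> \<le> a"
    and k: "k \<le> length s"
  shows "int \<delta> * - Delta s k \<le> int (min k \<delta>) * (2 * int (card E) - int (sum_list s))"
proof -
  obtain vs where vs: "distinct vs" "set vs \<subseteq> V" and s_vs: "list_all2 (\<lambda>a v. a \<le> degree E v) s vs"
    using dom by (auto simp: dominates_def)
  have len: "length s = length vs" using s_vs by (rule list_all2_lengthD)
  let ?deg = "\<lambda>v. int (degree E v)" and ?mdeg = "\<lambda>v. int (min k (degree E v))"
  let ?s1 = "take k s" and ?s2 = "drop k s"
  let ?vs1 = "take k vs" and ?vs2 = "drop k vs" and ?X = "V - set vs"
  let ?\<mu> = "int (min k \<delta>)"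
  have "2 * int (card E) = (\<Sum>v\<leftarrow>?vs1 @ ?vs2. ?deg v) + (\<Sum>v\<in>?X. ?deg v)"
    using twice_card_edges_eq_sum_list_degree[OF graph vs] by (simp only: append_take_drop_id)
  moreover have "int (sum_list s) = (\<Sum>a\<leftarrow>?s1 @ ?s2. int a)"
    unfolding append_take_drop_id by (rule sum_list_of_nat[symmetric])
  ultimately have excess: "2 * int (card E) - int (sum_list s) =
      ((\<Sum>v\<leftarrow>?vs1. ?deg v) - (\<Sum>a\<leftarrow>?s1. int a)) + ((\<Sum>v\<leftarrow>?vs2. ?deg v) - (\<Sum>a\<leftarrow>?s2. int a))
      + (\<Sum>v\<in>?X. ?deg v)"
    by (simp del: append_take_drop_id)
  have head: "(\<Sum>a\<leftarrow>?s1. int a) \<le> (\<Sum>v\<leftarrow>?vs1. ?deg v)"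
    by (rule sum_list_mono_list_all2[OF list_all2_takeI[OF s_vs]]) simp
  have tail: "int \<delta> * ((\<Sum>v\<leftarrow>?vs2. ?mdeg v) - (\<Sum>a\<leftarrow>?s2. int (min k a))) \<le>
      ?\<mu> * ((\<Sum>v\<leftarrow>?vs2. ?deg v) - (\<Sum>a\<leftarrow>?s2. int a))"
    by (rule scaled_sum_min_diff_le[OF list_all2_dropI[OF s_vs]])
      (use s_ge in \<open>auto dest: in_set_dropD\<close>)
  have "int \<delta> * ?mdeg v \<le> ?\<mu> * ?deg v" if "v \<in> ?X" for v
    using scaled_minus_min_mono[OF order_refl, of \<delta> "degree E v" k] deg_ge that
    by (simp add: min.commute)
  then have outside: "int \<delta> * (\<Sum>v\<in>?X. ?mdeg v) \<le> ?\<mu> * (\<Sum>v\<in>?X. ?deg v)"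
    unfolding sum_distrib_left by (rule sum_mono)
  have "int \<delta> * - Delta s k \<le> int \<delta> * ((\<Sum>v\<leftarrow>?vs2. ?mdeg v) - (\<Sum>a\<leftarrow>?s2. int (min k a))
      + (\<Sum>v\<in>?X. ?mdeg v))"
    using sum_list_degree_le[OF graph vs, of k] head k len
    by (intro mult_left_mono) (auto simp: Delta_eq_sum_list)
  also have "\<dots> \<le> ?\<mu> * ((\<Sum>v\<leftarrow>?vs2. ?deg v) - (\<Sum>a\<leftarrow>?s2. int a)) + ?\<mu> * (\<Sum>v\<in>?X. ?deg v)"
    unfolding distrib_left by (rule add_mono[OF tail outside])
  also have "\<dots> \<le> ?\<mu> * (2 * int (card E) - int (sum_list s))"
    unfolding excess distrib_left using head by simp
  finally show ?thesis .
qed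

lemma twos_needed_le_card_edges:
  assumes "simple_graph V E" and "dominates V E s" "\<And>v. v \<in> V \<Longrightarrow> 2 \<le> degree E v"
    and "\<And>a. a \<in> set s \<Longrightarrow> 2 \<le> a" and len: "2 \<le> length s" and even: "even (sum_list s)"
  shows "int (sum_list s) + 2 * twos_needed s \<le> 2 * int (card E)"
proof -
  define m where "m = int (card E) - int (sum_list s div 2)"
  have card_E: "2 * int (card E) = int (sum_list s) + 2 * m" using even by (auto simp: m_def)
  have "- Delta s k \<le> m * int (min k 2)" if "k \<in> {1..length s - 1}" for k
  proof -
    have "2 * - Delta s k \<le> int (min k 2) * (2 * m)"
      using minus_Delta_le_card_edges[of V E s 2 k] assms card_E that by auto
    then show ?thesis by (simp add: mult.commute)
  qed
  then have "twos_needed s \<le> m" using twos_needed_le_iff[OF len] by blast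
  then show ?thesis using card_E by simp
qed

lemma ell_q_eq_twos_needed:
  assumes sorted: "sorted_wrt (\<ge>) s" and len: "2 \<le> length s" "length s \<le> Suc (hd s)"
    and last: "last s = 2" and even: "even (sum_list s)"
    and dom: "\<And>(V :: nat set) E. simple_graph V E \<Longrightarrow> degree_set V E = set s \<Longrightarrow> dominates V E s"
  shows "2 * int (ell_q (set s)) = int (sum_list s) + 2 * twos_needed s"
proof -
  have ge2: "2 \<le> x" if "x \<in> set s" for x
    using sorted_wrt_ge_last_le[OF sorted that] last by simp
  have "0 \<le> twos_needed s" using twos_needed_nonneg[OF len] ge2 by fastforce
  then obtain V :: "nat set" and E where optimal: "simple_graph V E" "degree_set V E = set s"
      "2 * int (card E) = int (sum_list s) + 2 * twos_needed s"
    using exists_graph_twos_needed[OF sorted len(1) last even] by metis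
  then obtain V' :: "nat set" and E' where minimal: "simple_graph V' E'" "degree_set V' E' = set s"
      "card E' = ell_q (set s)"
    using ell_q_attained[OF optimal(1)] by auto
  have "2 \<le> degree E' v" if "v \<in> V'" for v
    using ge2 minimal(2) that by (auto simp: degree_set_def)
  then have "int (sum_list s) + 2 * twos_needed s \<le> 2 * int (card E')"
    using twos_needed_le_card_edges[OF minimal(1) dom[OF minimal(1,2)] _ ge2 len(1) even] by blast
  moreover have "ell_q (set s) \<le> card E" using ell_q_le[OF optimal(1)] optimal(2) by simp
  ultimately show ?thesis using optimal(3) minimal(3) by linarith
qed

section \<open>The sequence of a degree set\<close>

definition base_indices :: "(nat \<Rightarrow> nat) \<Rightarrow> nat \<Rightarrow> nat list" where
  "base_indices d n = (let r = last_odd d n in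
     if even (sigma (d ` {1..n})) then [1..<n + 1] else [1..<r] @ [r, r] @ [r + 1..<n + 1])"

definition base_seq :: "(nat \<Rightarrow> nat) \<Rightarrow> nat \<Rightarrow> nat list" where
  "base_seq d n = map d (base_indices d n)"

lemma exists_vertices_of_degrees:
  assumes "degree_set V E = d ` I" and "inj_on d I"
  obtains v where "inj_on v I" "v ` I \<subseteq> V" "\<And>i. i \<in> I \<Longrightarrow> degree E (v i) = d i"
proof -
  have "\<forall>i\<in>I. \<exists>v. v \<in> V \<and> degree E v = d i"
    using assms(1) by (force simp: degree_set_def)
  then obtain v where v: "\<And>i. i \<in> I \<Longrightarrow> v i \<in> V \<and> degree E (v i) = d i" by metis
  moreover have "inj_on v I" using v assms(2) by (metis inj_on_def)
  ultimately show thesis using that by blast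
qed

lemma upt_split_at: "m \<le> i \<Longrightarrow> i < n \<Longrightarrow> [m..<n] = [m..<i] @ i # [Suc i..<n]"
  using upt_add_eq_append[of m i "n - i"] by (simp add: upt_conv_Cons)

lemma dominates_map:
  assumes "distinct is" "inj_on v (set is)" "v ` set is \<subseteq> V"
    and "\<And>i. i \<in> set is \<Longrightarrow> d i \<le> degree E (v i)"
  shows "dominates V E (map d is)"
  unfolding dominates_def using assms
  by (intro exI[of _ "map v is"])
    (auto simp: distinct_map list_all2_map1 list_all2_map2 list_all2_same)

locale decreasing_degrees =
  fixes d :: "nat \<Rightarrow> nat" and n :: nat
  assumes n_ge_2: "2 \<le> n" and decreasing: "\<And>i j. 1 \<le> i \<Longrightarrow> i < j \<Longrightarrow> j \<le> n \<Longrightarrow> d j < d i"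
    and d_n: "d n = 2"
begin

abbreviation D :: "nat set" where
  "D \<equiv> d ` {1..n}"

abbreviation r :: nat where
  "r \<equiv> last_odd d n"

lemma d_antimono: "1 \<le> i \<Longrightarrow> i \<le> j \<Longrightarrow> j \<le> n \<Longrightarrow> d j \<le> d i"
  using decreasing[of i j] by (cases "i = j") auto

lemma inj_d: "inj_on d {1..n}"
  by (rule linorder_inj_onI) (use decreasing in \<open>fastforce+\<close>)

lemma sigma_eq_sum: "sigma D = (\<Sum>i=1..n. d i)"
  unfolding sigma_def by (rule sum.reindex[OF inj_d, of "\<lambda>a. a", unfolded o_def])

lemma n_le_d_1: "n \<le> d 1"
proof -
  have "D \<subseteq> {2..d 1}" using d_antimono d_n by fastforce
  then have "card D \<le> card {2..d 1}" by (intro card_mono) auto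
  then show ?thesis using card_image[OF inj_d] by simp
qed

lemma last_odd_in_if_odd: "i \<in> {1..n} \<Longrightarrow> odd (d i) \<Longrightarrow> r \<in> {i \<in> {1..n}. odd (d i)}"
  unfolding last_odd_def by (rule Max_in) auto

lemma last_odd_in:
  assumes "odd (sigma D)"
  shows "r \<in> {i \<in> {1..n}. odd (d i)}"
proof -
  have "\<exists>i\<in>{1..n}. odd (d i)"
    using assms dvd_sum[of "{1..n}" 2 d] sigma_eq_sum by fastforce
  then show ?thesis using last_odd_in_if_odd by blast
qed

lemma d_last_odd_le:
  assumes "a \<in> D" "odd a"
  shows "d r \<le> a"
proof -
  obtain i where i: "i \<in> {1..n}" "a = d i" using assms(1) by blast
  have "i \<le> r" unfolding last_odd_def by (rule Max_ge) (use i assms(2) in auto)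
  then show ?thesis using d_antimono[of i r] last_odd_in_if_odd[OF i(1)] i assms(2) by simp
qed

lemma base_seq_even: "even (sigma D) \<Longrightarrow> base_seq d n = seq_even d n"
  by (simp add: base_seq_def base_indices_def seq_even_def Let_def)

lemma base_seq_odd: "odd (sigma D) \<Longrightarrow> base_seq d n = seq_odd d n"
  by (simp add: base_seq_def base_indices_def seq_odd_def Let_def numeral_2_eq_2 del: upt_Suc)

lemma length_base_seq: "length (base_seq d n) = n + of_bool (odd (sigma D))"
  using last_odd_in by (auto simp: base_seq_def base_indices_def Let_def simp del: upt_Suc)

lemma set_base_indices: "set (base_indices d n) = {1..n}"
  using last_odd_in by (auto simp: base_indices_def Let_def simp del: upt_Suc)

lemma set_base_seq: "set (base_seq d n) = D"
  by (simp add: base_seq_def set_base_indices)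

lemma sorted_base_indices: "sorted (base_indices d n)"
  by (auto simp: base_indices_def Let_def sorted_append simp del: upt_Suc)

lemma sorted_base_seq: "sorted_wrt (\<ge>) (base_seq d n)"
  unfolding base_seq_def sorted_wrt_map
  by (rule sorted_wrt_mono_rel[OF _ sorted_base_indices])
    (auto simp: set_base_indices intro: d_antimono)

lemma hd_base_seq: "hd (base_seq d n) = d 1"
  using last_odd_in n_ge_2
  by (auto simp: base_seq_def base_indices_def Let_def hd_append hd_map upt_conv_Cons
      simp del: upt_Suc)

lemma last_base_seq: "last (base_seq d n) = 2"
proof -
  have "r < n" if "odd (sigma D)" using last_odd_in[OF that] d_n by (cases "r = n") auto
  then show ?thesis
    using n_ge_2 d_n by (auto simp: base_seq_def base_indices_def Let_def last_map)
qed

lemma sum_list_base_seq: "sum_list (base_seq d n) = sigma D + (if even (sigma D) then 0 else d r)"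
proof -
  have "sum_list (map d [1..<n + 1]) = sigma D"
    unfolding sigma_eq_sum
    by (simp add: interv_sum_list_conv_sum_set_nat atLeastLessThanSuc_atLeastAtMost del: upt_Suc)
  moreover have "sum_list (base_seq d n) = sum_list (map d [1..<n + 1]) + d r" if "odd (sigma D)"
    using that last_odd_in[OF that] upt_split_at[of 1 r "n + 1"]
    by (simp add: base_seq_def base_indices_def Let_def del: upt_Suc)
  ultimately show ?thesis by (simp add: base_seq_def base_indices_def Let_def del: upt_Suc)
qed

lemma even_sum_list_base_seq: "even (sum_list (base_seq d n))"
  using last_odd_in by (simp add: sum_list_base_seq)

lemma C_star_eq_twos_needed: "C_star d n = twos_needed (base_seq d n)"
  using length_base_seq by (simp add: C_star_def twos_needed_def base_seq_even base_seq_odd)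

lemma dominates_base_seq_even:
  assumes "even (sigma D)" and "degree_set V E = D"
  shows "dominates V E (base_seq d n)"
proof -
  obtain v where "inj_on v {1..n}" "v ` {1..n} \<subseteq> V" "\<And>i. i \<in> {1..n} \<Longrightarrow> degree E (v i) = d i"
    using exists_vertices_of_degrees[OF assms(2) inj_d] by blast
  then have "dominates V E (map d [1..<n + 1])"
    by (intro dominates_map[where v = v])
      (simp_all add: atLeastLessThanSuc_atLeastAtMost del: upt_Suc)
  then show ?thesis using assms(1) by (simp add: base_seq_def base_indices_def Let_def)
qed

lemma dominates_base_seq_odd:
  assumes odd: "odd (sigma D)" and graph: "simple_graph V E" and deg: "degree_set V E = D"
  shows "dominates V E (base_seq d n)"
proof -
  obtain v where v: "inj_on v {1..n}" "v ` {1..n} \<subseteq> V" "\<And>i. i \<in> {1..n} \<Longrightarrow> degree E (v i) = d i"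
    using exists_vertices_of_degrees[OF deg inj_d] by blast
  have "(\<Sum>u\<in>v ` {1..n}. degree E u) = sigma D"
    unfolding sigma_eq_sum sum.reindex[OF v(1)] by (intro sum.cong) (use v(3) in auto)
  then obtain w where w: "w \<in> V" "w \<notin> v ` {1..n}" "odd (degree E w)"
    using exists_odd_degree_outside[OF graph v(2)] odd by auto
  have "d r \<le> degree E w"
    using d_last_odd_le[OF _ w(3)] w(1) deg by (auto simp: degree_set_def)
  \<comment> \<open>The unused index \<open>0\<close> stands for the additional vertex \<open>w\<close>.\<close>
  let ?is = "[1..<r] @ [r, 0] @ [r + 1..<n + 1]"
  have set_is: "set ?is = insert 0 {1..n}"
    using last_odd_in[OF odd] by (auto simp del: upt_Suc)
  have "dominates V E (map (d(0 := d r)) ?is)"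
  proof (rule dominates_map[where v = "v(0 := w)"])
    show "distinct ?is" using last_odd_in[OF odd] by (auto simp del: upt_Suc)
    show "inj_on (v(0 := w)) (set ?is)"
      unfolding set_is using inj_on_fun_updI[OF v(1) w(2)] w(2) by (simp add: fun_upd_image)
    show "(v(0 := w)) ` set ?is \<subseteq> V"
      unfolding set_is using v(2) w(1) by auto
    show "(d(0 := d r)) i \<le> degree E ((v(0 := w)) i)" if "i \<in> set ?is" for i
      using that v(3) \<open>d r \<le> degree E w\<close> unfolding set_is by auto
  qed
  moreover have "map (d(0 := d r)) ?is = base_seq d n"
    using odd last_odd_in[OF odd] by (simp add: base_seq_def base_indices_def Let_def del: upt_Suc)
  ultimately show ?thesis by simp
qed

end

theorem theorem5:
  fixes D :: "nat set" and d :: "nat \<Rightarrow> nat" and n :: nat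
  assumes "n \<ge> 2"
    and "D = d ` {1..n}"
    and "\<And>x. x \<in> D \<Longrightarrow> 0 < x"
    and "\<And>i j. 1 \<le> i \<Longrightarrow> i < j \<Longrightarrow> j \<le> n \<Longrightarrow> d i > d j"
    and "Min D = d n"
    and "d n = 2"
  shows "real (ell_q D) = (real (sigma D) + 2 * real_of_int (C_star d n)) / 2
           + (if even (sigma D) then 0 else real (d (last_odd d n)) / 2)"
proof -
  interpret seq: decreasing_degrees d n
    using assms by unfold_locales auto
  have "2 * int (ell_q (set (base_seq d n))) =
      int (sum_list (base_seq d n)) + 2 * twos_needed (base_seq d n)"
  proof (rule ell_q_eq_twos_needed)
    show "2 \<le> length (base_seq d n)" "length (base_seq d n) \<le> Suc (hd (base_seq d n))"
      using assms(1) seq.n_le_d_1 by (auto simp: seq.length_base_seq seq.hd_base_seq)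
    show "dominates V E (base_seq d n)"
      if "simple_graph V E" "degree_set V E = set (base_seq d n)" for V :: "nat set" and E
      using that seq.dominates_base_seq_even seq.dominates_base_seq_odd seq.set_base_seq by metis
  qed (fact seq.sorted_base_seq seq.last_base_seq seq.even_sum_list_base_seq)+
  then have "2 * int (ell_q D) =
      int (sigma D) + int (if even (sigma D) then 0 else d (last_odd d n)) + 2 * C_star d n"
    by (simp add: seq.set_base_seq seq.sum_list_base_seq seq.C_star_eq_twos_needed assms(2))
  then have "real_of_int (2 * int (ell_q D)) = real_of_int (int (sigma D) +
      int (if even (sigma D) then 0 else d (last_odd d n)) + 2 * C_star d n)" by simp
  then show ?thesis by (simp add: add_divide_distrib split: if_splits)
qed

end
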